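(* Let $q$ be a prime power, $r>h\ge 1$ integers, $g:=\gcd(r,h)$, and $\varepsilon_1,\dots,\varepsilon_{r-1}\in\mathbb{Z}$ such that $q^{h-i}$ divides $\varepsilon_i$ for all $1\le i<h$ and $$\sum_{i=1}^{r-1}\varepsilon_i\cdot[i]_q\equiv 0\pmod{[g]_q}.$$ Then $\star[r]-\sum_{i=1}^{r-1}\varepsilon_i[i]$ is $h$-partitionable over $\mathbb{F}_q$.
   Context: Notation: $[i]_q=\frac{q^i-1}{q-1}$. $\mathrm{PG}(r-1,q)$ denotes the lattice of subspaces of $V=\mathbb{F}_q^r$; dimensions are vector space dimensions, and points are the $1$-dimensional subspaces. For a subspace $S$, $\chi_S$ is the function on points with $\chi_S(P)=1$ if $P\le S$ and $\chi_S(P)=0$ otherwise. For $\sigma\in\mathbb{N}$ and $\varepsilon_1,\dots,\varepsilon_{r-1}\in\mathbb{Z}$ we say that $\sigma[r]-\sum_{i=1}^{r-1}\varepsilon_i[i]$ is $h$-partitionable over $\mathbb{F}_q$ if there exist a (finite) multiset $\mathcal{S}$ of $h$-dimensional subspaces of $\mathbb{F}_q^r$ and a chain of subspaces $S_1\le S_2\le\dots\le S_{r-1}$ with $\dim(S_i)=i$ such that $$\sum_{S\in\mathcal{S}}\chi_S=\sigma\cdot\chi_V-\sum_{i=1}^{r-1}\varepsilon_i\cdot\chi_{S_i}.$$ We say that $\star[r]-\sum_{i=1}^{r-1}\varepsilon_i[i]$ is $h$-partitionable over $\mathbb{F}_q$ if there exists a $\sigma$ such that $\sigma[r]-\sum_{i=1}^{r-1}\varepsilon_i[i]$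 is $h$-partitionable over $\mathbb{F}_q$. *)

theory Defs
  imports
    "HOL-Analysis.Cartesian_Space"
    "HOL-Number_Theory.Prime_Powers"
    "HOL-Number_Theory.Cong"
    "HOL-Library.Multiset"
begin

definition q_int :: "nat \<Rightarrow> nat \<Rightarrow> int" where
  "q_int q i = (int q ^ i - 1) div (int q - 1)"

text \<open>The integer division in \<open>q_int\<close> is exact:\<close>

lemma of_int_q_int:
  assumes "q \<ge> 2"
  shows "(of_int (q_int q i) :: rat) = (of_nat q ^ i - 1) / (of_nat q - 1)"
proof -
  have "int q - 1 dvd int q ^ i - 1"
    using power_diff_1_eq[of "int q" i] by simp
  then have "q_int q i * (int q - 1) = int q ^ i - 1"
    unfolding q_int_def by simp
  then have "(of_int (q_int q i * (int q - 1)) :: rat) = of_int (int q ^ i - 1)"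
    by (rule arg_cong)
  with assms show ?thesis by (simp add: field_simps)
qed

definition points :: "('a::field ^ 'n::finite) set set" where
  "points = {P. vec.subspace P \<and> vec.dim P = 1}"

definition chi :: "('a::field ^ 'n::finite) set \<Rightarrow> ('a ^ 'n) set \<Rightarrow> int" where
  "chi S P = (if P \<subseteq> S then 1 else 0)"

text \<open>The two type arguments determine the ambient space: the ground field is \<open>'a\<close>,
  \<open>r\<close> is the cardinality of the index type \<open>'n\<close>, and \<open>V = UNIV\<close>.  Only the values
  \<open>\<epsilon> 1, \<dots>, \<epsilon> (r - 1)\<close> and \<open>F 1, \<dots>, F (r - 1)\<close> are relevant.\<close>

definition partitionable ::
  "'a::{field,finite} itself \<Rightarrow> 'n::finite itself \<Rightarrow> nat \<Rightarrow> nat \<Rightarrow> (nat \<Rightarrow> int) \<Rightarrow> bool" where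
  "partitionable _ _ h \<sigma> \<epsilon> \<longleftrightarrow>
    (\<exists>(M :: ('a ^ 'n) set multiset) (F :: nat \<Rightarrow> ('a ^ 'n) set).
      (\<forall>S \<in># M. vec.subspace S \<and> vec.dim S = h) \<and>
      (\<forall>i \<in> {1..<CARD('n)}. vec.subspace (F i) \<and> vec.dim (F i) = i) \<and>
      (\<forall>i \<in> {1..<CARD('n)}. \<forall>j \<in> {1..<CARD('n)}. i \<le> j \<longrightarrow> F i \<subseteq> F j) \<and>
      (\<forall>P \<in> points.
        (\<Sum>S \<in># M. chi S P) =
          int \<sigma> * chi UNIV P - (\<Sum>i = 1..<CARD('n). \<epsilon> i * chi (F i) P)))"

definition star_partitionable ::
  "'a::{field,finite} itself \<Rightarrow> 'n::finite itself \<Rightarrow> nat \<Rightarrow> (nat \<Rightarrow> int) \<Rightarrow> bool" where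
  "star_partitionable K N h \<epsilon> \<longleftrightarrow> (\<exists>\<sigma>. partitionable K N h \<sigma> \<epsilon>)"

end

theory Submission
  imports Defs
begin

text \<open>
  Work in the group of integer functions on points modulo the lattice spanned by the
  characteristic functions of the \<open>h\<close>-spaces. If \<open>K\<close> has codimension 2 in \<open>U\<close>, the \<open>q + 1\<close>
  hyperplanes of \<open>U\<close> through \<open>K\<close> give \<open>\<Sum> \<chi>\<^sub>H = \<chi>\<^sub>U + q \<chi>\<^sub>K\<close>. By induction on dimensions, this one
  identity shows that all \<open>(h + 1)\<close>-spaces lie in a single class \<open>w\<close> with \<open>[h] w = 0\<close>, that every
  space of dimension \<open>m \<ge> h\<close> has class \<open>[m] w\<close>, and that \<open>q ^ (h - i)\<close> times a space of dimension
  \<open>i < h\<close> has class \<open>q ^ (h - i) [i] w\<close>. Hence \<open>\<sigma> \<chi>\<^sub>V - \<Sum> \<epsilon>\<^sub>i \<chi>(S\<^sub>i)\<close> is in the lattice as soon as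
  \<open>\<sigma> [r] \<equiv> \<Sum> \<epsilon>\<^sub>i [i]\<close> modulo \<open>[h]\<close>, which is solvable since \<open>[gcd r h]\<close> is an integer combination
  of \<open>[r]\<close> and \<open>[h]\<close>. The sum over all \<open>h\<close>-spaces is a positive multiple of \<open>\<chi>\<^sub>V\<close>, so adding it
  often enough makes all coefficients nonnegative.
\<close>

section \<open>Arithmetic of the integers [i]_q\<close>

lemma q_int_mult:
  assumes "q \<ge> 2"
  shows "q_int q i * (int q - 1) = int q ^ i - 1"
proof -
  have "int q - 1 dvd int q ^ i - 1"
    using power_diff_1_eq[of "int q" i] by simp
  then show ?thesis unfolding q_int_def by simp
qed

lemma q_int_0 [simp]: "q_int q 0 = 0"
  by (simp add: q_int_def)

lemma q_int_add:
  assumes "q \<ge> 2"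
  shows "q_int q (m + n) = q_int q n + int q ^ n * q_int q m"
proof -
  have "q_int q (m + n) * (int q - 1) = (q_int q n + int q ^ n * q_int q m) * (int q - 1)"
    unfolding distrib_right mult.assoc q_int_mult[OF assms]
    by (simp add: algebra_simps power_add)
  then show ?thesis using assms by simp
qed

lemma q_int_1 [simp]: "q \<ge> 2 \<Longrightarrow> q_int q (Suc 0) = 1"
  using q_int_mult[of q 1] by simp

lemma q_int_Suc:
  assumes "q \<ge> 2"
  shows "q_int q (Suc n) = 1 + int q * q_int q n"
  using q_int_add[OF assms, of n 1] assms by simp

text \<open>This recurrence mirrors the pencil identity: q + 1 middle spaces count as the top space
  plus q copies of the bottom one. It closes both inductions over pencils.\<close>

lemma q_int_Suc_Suc:
  assumes "q \<ge> 2"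
  shows "q_int q (Suc (Suc n)) = (int q + 1) * q_int q (Suc n) - int q * q_int q n"
  using assms by (simp add: q_int_Suc algebra_simps)

text \<open>Subtractive Euclidean algorithm: if n = k + m, then [n] = [k] + q^k [m], so a
  combination for (m, k) turns into one for (m, n).\<close>

lemma q_int_bezout:
  assumes "q \<ge> 2"
  shows "\<exists>x y. x * q_int q m + y * q_int q n = q_int q (gcd m n)"
proof (induction "m + n" arbitrary: m n rule: less_induct)
  case less
  show ?case
  proof (cases "m = 0 \<or> n = 0")
    case True
    then show ?thesis by (metis add_0 add.commute gcd_0_left_nat gcd_0_nat mult_1 mult_zero_left)
  next
    case False
    show ?thesis
    proof (cases "m \<le> n")
      case True
      define k where "k = n - m"
      have n: "n = k + m" using True k_def by simp
      obtain x y where "x * q_int q m + y * q_int q k = q_int q (gcd m k)"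
        using less[of m k] False n by auto
      moreover have "gcd m k = gcd m n" using n by (metis gcd_add2 add.commute)
      moreover have "q_int q n = q_int q k + int q ^ k * q_int q m"
        using q_int_add[OF assms, of m k] n by (simp add: add.commute)
      then have "(x - y * int q ^ k) * q_int q m + y * q_int q n = x * q_int q m + y * q_int q k"
        by (simp add: algebra_simps)
      ultimately have "(x - y * int q ^ k) * q_int q m + y * q_int q n = q_int q (gcd m n)"
        by presburger
      then show ?thesis by blast
    next
      case nle: False
      define k where "k = m - n"
      have m: "m = k + n" using nle k_def by simp
      obtain x y where "x * q_int q k + y * q_int q n = q_int q (gcd k n)"
        using less[of k n] False m nle by auto
      moreover have "gcd k n = gcd m n" using m by simp
      moreover have "q_int q m = q_int q k + int q ^ k * q_int q n"
        using q_int_add[OF assms, of n k] m by (simp add: add.commute)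
      then have "x * q_int q m + (y - x * int q ^ k) * q_int q n = x * q_int q k + y * q_int q n"
        by (simp add: algebra_simps)
      ultimately have "x * q_int q m + (y - x * int q ^ k) * q_int q n = q_int q (gcd m n)"
        by presburger
      then show ?thesis by blast
    qed
  qed
qed

section \<open>Points, subspaces and pencils of hyperplanes\<close>

lemma point_cases:
  assumes "P \<in> points"
  obtains x where "x \<noteq> 0" "P = vec.span {x}"
proof -
  obtain B where B: "B \<subseteq> P" "vec.independent B" "P \<subseteq> vec.span B" "card B = vec.dim P"
    using vec.basis_exists by blast
  have P: "vec.subspace P" "vec.dim P = 1" using assms by (auto simp: points_def)
  then obtain x where x: "B = {x}" using B by (metis card_1_singletonE)
  have "vec.span B \<subseteq> P" using B(1) P(1) by (rule vec.span_minimal)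
  moreover have "x \<noteq> 0" using B(2) x vec.dependent_zero by blast
  ultimately show ?thesis using that x B(3) by blast
qed

lemma chi_span:
  assumes "vec.subspace S"
  shows "chi S (vec.span {x}) = of_bool (x \<in> S)"
  using assms vec.span_minimal[of "{x}" S] vec.span_base[of x "{x}"]
  by (auto simp: chi_def)

lemma dim_insert_subspace:
  assumes "vec.subspace K" and "u \<notin> K"
  shows "vec.dim (insert u K) = Suc (vec.dim K)"
proof -
  have "u \<notin> vec.span K" using assms by (metis vec.span_eq_iff)
  then show ?thesis by (simp add: vec.dim_insert)
qed

lemma subspace_between:
  fixes S T :: "('a::field ^ 'n::finite) set"
  assumes S: "vec.subspace S" and T: "vec.subspace T" and "S \<subseteq> T"
    and "vec.dim S \<le> k" and "k \<le> vec.dim T"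
  shows "\<exists>U. vec.subspace U \<and> S \<subseteq> U \<and> U \<subseteq> T \<and> vec.dim U = k"
  using assms(4,5)
proof (induction k rule: dec_induct)
  case base
  then show ?case using assms by blast
next
  case (step k)
  then obtain U where U: "vec.subspace U" "S \<subseteq> U" "U \<subseteq> T" "vec.dim U = k" by auto
  obtain u where u: "u \<in> T" "u \<notin> U"
    using U(3,4) step.prems by (metis Suc_n_not_le_n subset_antisym subsetI)
  have "vec.span (insert u U) \<subseteq> T" using u U T by (intro vec.span_minimal) auto
  moreover have "vec.dim (vec.span (insert u U)) = Suc k"
    using u U by (simp add: dim_insert_subspace)
  ultimately show ?case
    using U(2) vec.subspace_span vec.span_superset[of "insert u U"] by blast
qed

text \<open>The spaces strictly between K and U are the points of the projective line of U/K. The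
  type \<open>'a option\<close> parametrises them: \<open>Some a\<close> stands for slope a,
  \<open>None\<close> for infinity. A point of K lies on all q + 1 of them, any other point of U on
  exactly one.\<close>

lemma pencil:
  fixes K U :: "('a::{field,finite} ^ 'n::finite) set"
  assumes K: "vec.subspace K" and U: "vec.subspace U" and KU: "K \<subseteq> U"
    and dim: "vec.dim U = vec.dim K + 2"
  obtains G :: "'a option \<Rightarrow> ('a ^ 'n) set"
  where "\<And>a. vec.subspace (G a)" "\<And>a. G a \<subseteq> U" "\<And>a. vec.dim (G a) = vec.dim K + 1"
    "\<And>P. P \<in> points \<Longrightarrow> (\<Sum>a\<in>UNIV. chi (G a) P) = chi U P + int CARD('a) * chi K P"
proof -
  have spanK: "vec.span K = K" using K by (simp add: vec.span_eq_iff)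
  obtain u where u: "u \<in> U" "u \<notin> K"
    using dim KU by (metis add_eq_self_zero subset_antisym subsetI zero_neq_numeral)
  \<comment> \<open>The vectors u and v complete K to U: v avoids \<open>L\<close>, so
    \<open>M\<close>, the span of K, u and v, reaches the dimension of U.\<close>
  define L where "L = vec.span (insert u K)"
  have L: "vec.subspace L" "L \<subseteq> U" "vec.dim L = vec.dim K + 1"
    using u U KU K vec.span_minimal[of "insert u K" U]
    by (simp_all add: L_def dim_insert_subspace)
  obtain v where v: "v \<in> U" "v \<notin> L"
    using dim L by (metis add_left_cancel one_eq_numeral_iff semiring_norm(85) subset_antisym subsetI)
  define M where "M = vec.span (insert v (insert u K))"
  have "M \<subseteq> U" using u v U KU vec.span_minimal[of "insert v (insert u K)" U] by (auto simp: M_def)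
  moreover have "vec.dim M = vec.dim U"
    using v dim L(3) by (simp add: M_def vec.dim_insert L_def)
  ultimately have M: "M = U"
    using U vec.subspace_dim_equal[of M U] by (simp add: M_def)
  define G where "G = (\<lambda>a. vec.span (insert (case a of None \<Rightarrow> v | Some a \<Rightarrow> u + a *s v) K))"
  have memL: "x \<in> L \<longleftrightarrow> (\<exists>k. x - k *s u \<in> K)" for x
    unfolding L_def by (simp add: vec.span_breakdown_eq spanK)
  have memU: "x \<in> U \<longleftrightarrow> (\<exists>b a. x - b *s v - a *s u \<in> K)" for x
    unfolding M[symmetric] M_def by (simp add: vec.span_breakdown_eq spanK)
  \<comment> \<open>u and v are independent modulo K, which makes coordinates in U/K unique.\<close>
  have zero: "a = 0 \<and> b = 0" if "b *s v + a *s u \<in> K" for a b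
  proof -
    have "b = 0"
    proof (rule ccontr)
      assume "b \<noteq> 0"
      have "(1 / b) *s (b *s v + a *s u) \<in> K" using that K by (rule vec.subspace_scale[rotated])
      then have "v - (- (a / b)) *s u \<in> K" using \<open>b \<noteq> 0\<close> by (simp add: vec.scale_right_distrib)
      then show False using v memL by blast
    qed
    moreover have "a = 0"
    proof (rule ccontr)
      assume "a \<noteq> 0"
      have "(1 / a) *s (a *s u) \<in> K"
        using that K \<open>b = 0\<close> vec.subspace_scale[of K "a *s u" "1 / a"] by simp
      then show False using u \<open>a \<noteq> 0\<close> by simp
    qed
    ultimately show ?thesis by simp
  qed
  have memG: "x \<in> G c \<longleftrightarrow> (\<exists>k. x - k *s (case c of None \<Rightarrow> v | Some a \<Rightarrow> u + a *s v) \<in> K)" for x c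
    unfolding G_def by (simp add: vec.span_breakdown_eq spanK)
  have uv: "u + a *s v \<notin> K" "v \<notin> K" for a
    using zero[of a 1] zero[of 1 0] by (auto simp: add.commute)
  have G: "vec.subspace (G c)" "G c \<subseteq> U" "vec.dim (G c) = vec.dim K + 1" for c
  proof -
    show "vec.subspace (G c)" by (simp add: G_def)
    show "G c \<subseteq> U" unfolding G_def
      using u v U KU
      by (intro vec.span_minimal) (auto intro: vec.subspace_add vec.subspace_scale split: option.split)
    show "vec.dim (G c) = vec.dim K + 1"
      using uv K by (auto simp: G_def dim_insert_subspace split: option.split)
  qed
  have count: "(\<Sum>c\<in>UNIV. chi (G c) P) = chi U P + int CARD('a) * chi K P" if P: "P \<in> points" for P
  proof -
    obtain x where x: "P = vec.span {x}" using P by (rule point_cases)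
    have chi: "chi S P = of_bool (x \<in> S)" if "vec.subspace S" for S
      using that x by (simp add: chi_span)
    consider "x \<in> K" | "x \<notin> U" | "x \<in> U" "x \<notin> K" by blast
    then show ?thesis
    proof cases
      case 1
      then have "x \<in> U" "x \<in> G c" for c using KU memG[of x c] by (auto intro: exI[of _ 0])
      then show ?thesis using 1 G K U by (simp add: chi card_UNIV_option)
    next
      case 2
      then have "x \<notin> K" "x \<notin> G c" for c using KU G(2) by auto
      then show ?thesis using 2 G K U by (simp add: chi)
    next
      case 3
      obtain b a where ab: "x - b *s v - a *s u \<in> K" using 3 memU by blast
      \<comment> \<open>Modulo K, x has coordinate a along u and b along v, not both 0 because x is
        outside K.\<close>
      define k where "k = x - b *s v - a *s u"
      have k: "k \<in> K" and xk: "x = k + b *s v + a *s u" using ab by (simp_all add: k_def)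
      have nz: "a \<noteq> 0 \<or> b \<noteq> 0" using 3 xk k by auto
      have N: "x \<in> G None \<longleftrightarrow> a = 0"
      proof
        assume "x \<in> G None"
        then obtain t where "x - t *s v \<in> K" using memG by auto
        then have "(x - t *s v) - k \<in> K" using k K vec.subspace_diff by blast
        then have "(b - t) *s v + a *s u \<in> K" by (simp add: xk vec.scale_left_diff_distrib algebra_simps)
        then show "a = 0" using zero by blast
      next
        assume "a = 0"
        then show "x \<in> G None" using k xk memG[of x None] by (auto intro: exI[of _ b])
      qed
      have S: "x \<in> G (Some c) \<longleftrightarrow> b = a * c" for c
      proof
        assume "x \<in> G (Some c)"
        then obtain t where "x - t *s (u + c *s v) \<in> K" using memG by auto
        then have "(x - t *s (u + c *s v)) - k \<in> K" using k K vec.subspace_diff by blast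
        then have "(b - t * c) *s v + (a - t) *s u \<in> K"
          by (simp add: xk vec.scale_left_diff_distrib vec.scale_right_distrib algebra_simps)
        then show "b = a * c" using zero[of "b - t * c" "a - t"] by simp
      next
        assume "b = a * c"
        then have "x - a *s (u + c *s v) \<in> K" using k xk by (simp add: vec.scale_right_distrib)
        then show "x \<in> G (Some c)" using memG[of x "Some c"] by auto
      qed
      \<comment> \<open>The line through (a, b) in U/K has exactly one slope: b / a, or infinity if
        a = 0.\<close>
      have "{c. x \<in> G c} = {if a = 0 then None else Some (b / a)}"
      proof (rule set_eqI)
        fix c show "c \<in> {c. x \<in> G c} \<longleftrightarrow> c \<in> {if a = 0 then None else Some (b / a)}"
          using N S nz by (cases c) (auto simp: field_simps)
      qed
      then have "(\<Sum>c\<in>UNIV. of_bool (x \<in> G c) :: int) = 1" by (simp add: sum_of_bool_eq)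
      then show ?thesis using 3 G K U by (simp add: chi)
    qed
  qed
  show ?thesis using that G count by blast
qed

lemma card_field_ge_2: "CARD('a::{field,finite}) \<ge> 2"
  using card_mono[of UNIV "{0, 1 :: 'a}"] by simp

section \<open>Integer combinations of h-spaces, and classes of subspaces modulo them\<close>

definition subspaces :: "nat \<Rightarrow> ('a::field ^ 'n::finite) set set" where
  "subspaces h = {S. vec.subspace S \<and> vec.dim S = h}"

text \<open>The functions take arbitrary sets as arguments, so membership constrains only their
  values on points. Coefficients may be negative; signs are repaired at the very end.\<close>

definition chi_lattice :: "nat \<Rightarrow> (('a::{field,finite} ^ 'n::finite) set \<Rightarrow> int) set" where
  "chi_lattice h = {f. \<exists>c. \<forall>P\<in>points. f P = (\<Sum>S\<in>subspaces h. c S * chi S P)}"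

text \<open>Because the target is compared on points only, later memberships reduce to integer
  identities between values of \<open>chi\<close>.\<close>

lemma chi_lattice_lincomb:
  fixes f g k :: "('a::{field,finite} ^ 'n::finite) set \<Rightarrow> int"
  assumes "f \<in> chi_lattice h" "g \<in> chi_lattice h"
    and "\<And>P. P \<in> points \<Longrightarrow> k P = a * f P + b * g P"
  shows "k \<in> chi_lattice h"
proof -
  obtain c d where cd: "\<forall>P\<in>points. f P = (\<Sum>S\<in>subspaces h. c S * chi S P)"
    "\<forall>P\<in>points. g P = (\<Sum>S\<in>subspaces h. d S * chi S P)"
    using assms by (auto simp: chi_lattice_def)
  have "\<forall>P\<in>points. k P = (\<Sum>S\<in>subspaces h. (a * c S + b * d S) * chi S P)"
    using cd assms(3) by (simp add: sum_distrib_left sum.distrib distrib_right mult.assoc)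
  then show ?thesis unfolding chi_lattice_def mem_Collect_eq
    by (intro exI[of _ "\<lambda>S. a * c S + b * d S"])
qed

lemma chi_lattice_scale:
  assumes "f \<in> chi_lattice h" "\<And>P. P \<in> points \<Longrightarrow> k P = a * f P"
  shows "k \<in> chi_lattice h"
  using chi_lattice_lincomb[OF assms(1,1), of k a 0] assms(2) by simp

lemma chi_lattice_sum:
  assumes "\<And>a. a \<in> A \<Longrightarrow> f a \<in> chi_lattice h"
  shows "(\<lambda>P. \<Sum>a\<in>A. f a P) \<in> chi_lattice h"
  using assms
proof (induction A rule: infinite_finite_induct)
  case (insert x F)
  show ?case
    by (rule chi_lattice_lincomb[of "f x" h "\<lambda>P. \<Sum>a\<in>F. f a P" _ 1 1])
      (use insert in simp_all)
qed (auto simp: chi_lattice_def intro: exI[of _ "\<lambda>_. 0"])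

lemma chi_in_chi_lattice:
  fixes S :: "('a::{field,finite} ^ 'n::finite) set"
  assumes "vec.subspace S" "vec.dim S = h"
  shows "chi S \<in> chi_lattice h"
proof -
  have "\<forall>P\<in>points. chi S P = (\<Sum>T\<in>subspaces h. of_bool (T = S) * chi T P)"
    using assms sum.delta[of "subspaces h" S "\<lambda>T. chi T P"]
    by (simp add: subspaces_def of_bool_def if_distrib[of "\<lambda>x. x * _"] cong: if_cong)
  then show ?thesis unfolding chi_lattice_def mem_Collect_eq
    by (intro exI[of _ "\<lambda>T. of_bool (T = S)"])
qed

text \<open>Induction on the defect d. For d = 0, S is itself an h-space, and for d = 1 the pencil
  of S in W consists of h-spaces. For larger d, take a pencil of S in some U inside W: its members
  have defect d - 1 and U has defect d - 2.\<close>

lemma chi_lattice_low_dim: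
  fixes S W :: "('a::{field,finite} ^ 'n::finite) set"
  defines "q \<equiv> CARD('a)"
  assumes W: "vec.subspace W" "vec.dim W = Suc h"
    and "vec.subspace S" "S \<subseteq> W" "vec.dim S + d = h"
  shows "(\<lambda>P. int q ^ d * chi S P + q_int q d * chi W P) \<in> chi_lattice h"
  using assms(4-)
proof (induction d arbitrary: S rule: less_induct)
  case (less d)
  have q: "q \<ge> 2" by (simp add: q_def card_field_ge_2)
  consider "d = 0" | "d = 1" | e where "d = Suc (Suc e)"
    by (metis One_nat_def not0_implies_Suc)
  then show ?case
  proof cases
    case 1
    then show ?thesis using less.prems chi_in_chi_lattice[of S h] by simp
  next
    case 2
    then have "vec.dim W = vec.dim S + 2" using less.prems W by simp
    then obtain G :: "'a option \<Rightarrow> ('a ^ 'n) set" where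
      G: "\<And>a. vec.subspace (G a)" "\<And>a. G a \<subseteq> W" "\<And>a. vec.dim (G a) = vec.dim S + 1"
        "\<And>P. P \<in> points \<Longrightarrow> (\<Sum>a\<in>UNIV. chi (G a) P) = chi W P + int q * chi S P"
      using pencil[OF less.prems(1) W(1) less.prems(2), folded q_def] by blast
    have "(\<lambda>P. \<Sum>a\<in>UNIV. chi (G a) P) \<in> chi_lattice h"
      using G less.prems 2 by (intro chi_lattice_sum chi_in_chi_lattice) auto
    then show ?thesis
      by (rule chi_lattice_scale[where a = 1]) (use G(4) 2 q in simp)
  next
    case 3
    obtain U where U: "vec.subspace U" "S \<subseteq> U" "U \<subseteq> W" "vec.dim U = vec.dim S + 2"
      using subspace_between[of S W "vec.dim S + 2"] less.prems W 3 by auto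
    obtain G :: "'a option \<Rightarrow> ('a ^ 'n) set" where
      G: "\<And>a. vec.subspace (G a)" "\<And>a. G a \<subseteq> U" "\<And>a. vec.dim (G a) = vec.dim S + 1"
        "\<And>P. P \<in> points \<Longrightarrow> (\<Sum>a\<in>UNIV. chi (G a) P) = chi U P + int q * chi S P"
      using pencil[OF less.prems(1) U(1,2,4), folded q_def] by blast
    have "(\<lambda>P. int q ^ Suc e * chi (G a) P + q_int q (Suc e) * chi W P) \<in> chi_lattice h" for a
      using G(1-3)[of a] U less.prems 3 by (intro less.IH) auto
    then have "(\<lambda>P. \<Sum>a\<in>UNIV. int q ^ Suc e * chi (G a) P + q_int q (Suc e) * chi W P)
        \<in> chi_lattice h"
      by (intro chi_lattice_sum)
    moreover have "(\<lambda>P. int q ^ e * chi U P + q_int q e * chi W P) \<in> chi_lattice h"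
      using U less.prems 3 by (intro less.IH) auto
    \<comment> \<open>The weights 1 and -q cancel the terms in \<open>chi U\<close>; the
      coefficients of \<open>chi W\<close> combine by the recurrence for [i].\<close>
    ultimately show ?thesis
    proof (rule chi_lattice_lincomb[where a = 1 and b = "- int q"])
      fix P :: "('a ^ 'n) set"
      assume P: "P \<in> points"
      have "(\<Sum>a\<in>(UNIV :: 'a option set). int q ^ Suc e * chi (G a) P + q_int q (Suc e) * chi W P)
          = int q ^ Suc e * (chi U P + int q * chi S P) + (int q + 1) * q_int q (Suc e) * chi W P"
        using G(4)[OF P]
        by (simp add: sum.distrib sum_distrib_left[symmetric] card_UNIV_option q_def)
      then show "int q ^ d * chi S P + q_int q d * chi W P =
          1 * (\<Sum>a\<in>(UNIV :: 'a option set). int q ^ Suc e * chi (G a) P + q_int q (Suc e) * chi W P)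
          + - int q * (int q ^ e * chi U P + q_int q e * chi W P)"
        unfolding 3 q_int_Suc_Suc[OF q] by (simp add: algebra_simps)
    qed
  qed
qed

text \<open>The zero space has defect h and contains no point, so only the term in W
  survives.\<close>

lemma chi_lattice_Suc:
  fixes W :: "('a::{field,finite} ^ 'n::finite) set"
  assumes W: "vec.subspace W" "vec.dim W = Suc h"
  shows "(\<lambda>P. q_int CARD('a) h * chi W P) \<in> chi_lattice h"
proof -
  have "(\<lambda>P. int CARD('a) ^ h * chi {0} P + q_int CARD('a) h * chi W P) \<in> chi_lattice h"
    using W by (intro chi_lattice_low_dim) (auto simp: vec.subspace_0)
  moreover have "chi {0} P = 0" if "P \<in> points" for P :: "('a ^ 'n) set"
    using that by (auto elim!: point_cases simp: chi_span)
  ultimately show ?thesis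
    by (elim chi_lattice_scale[where a = 1]) simp
qed

text \<open>If W and W' share a nonzero vector, comparing its span in both puts [h-1] times the
  difference into the lattice. So is [h] times it, and [h] - q [h-1] = 1. In general, pass through a
  third space that meets both.\<close>

lemma chi_lattice_Suc_diff:
  fixes W W' :: "('a::{field,finite} ^ 'n::finite) set"
  assumes h: "h \<ge> 1"
    and W: "vec.subspace W" "vec.dim W = Suc h" and W': "vec.subspace W'" "vec.dim W' = Suc h"
  shows "(\<lambda>P. chi W P - chi W' P) \<in> chi_lattice h"
proof -
  obtain d where d: "h = Suc d" using h by (cases h) auto
  define q where "q = CARD('a)"
  have q: "q \<ge> 2" by (simp add: q_def card_field_ge_2)
  have meet: "(\<lambda>P. chi W P - chi W' P) \<in> chi_lattice h"
    if "x \<noteq> 0" "x \<in> W" "x \<in> W'"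
      and W: "vec.subspace W" "vec.dim W = Suc h" and W': "vec.subspace W'" "vec.dim W' = Suc h"
    for x and W W' :: "('a ^ 'n) set"
  proof -
    have "vec.dim {x} = 1" using \<open>x \<noteq> 0\<close> vec.dim_insert[of x "{}"] by simp
    then have *: "(\<lambda>P. int q ^ d * chi (vec.span {x}) P + q_int q d * chi X P) \<in> chi_lattice h"
      if "vec.subspace X" "vec.dim X = Suc h" "x \<in> X" for X
      unfolding q_def using that d
      by (intro chi_lattice_low_dim vec.span_minimal) auto
    have "(\<lambda>P. q_int q d * (chi W P - chi W' P)) \<in> chi_lattice h"
      by (rule chi_lattice_lincomb[where a = 1 and b = "-1", OF *[of W] *[of W']])
        (use that in \<open>auto simp: algebra_simps\<close>)
    moreover have "(\<lambda>P. q_int q h * (chi W P - chi W' P)) \<in> chi_lattice h"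
      by (rule chi_lattice_lincomb[where a = 1 and b = "-1",
            OF chi_lattice_Suc[OF W] chi_lattice_Suc[OF W']])
        (auto simp: algebra_simps q_def)
    ultimately show ?thesis
      by (rule chi_lattice_lincomb[where a = "- int q" and b = 1])
        (simp add: d q_int_Suc[OF q] algebra_simps)
  qed
  have ex: "\<exists>x. x \<in> X \<and> x \<noteq> 0" if "vec.dim X = Suc h" for X :: "('a ^ 'n) set"
    using that vec.dim_eq_0[of X] by auto
  obtain x y where x: "x \<in> W" "x \<noteq> 0" and y: "y \<in> W'" "y \<noteq> 0"
    using ex W W' by metis
  \<comment> \<open>A third space through x and y fits because h + 1 is at least 2.\<close>
  have "vec.dim {x, y} \<le> Suc h"
    using vec.dim_le_card'[of "{x, y}"] card_insert_le_m1[of 2 "{y}" x] h by simp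
  moreover have "Suc h \<le> vec.dim (UNIV :: ('a ^ 'n) set)"
    using vec.dim_subset[of W UNIV] W by simp
  ultimately obtain X where X: "vec.subspace X" "vec.span {x, y} \<subseteq> X" "vec.dim X = Suc h"
    using subspace_between[of "vec.span {x, y}" UNIV "Suc h"] by auto
  have "x \<in> X" "y \<in> X" using X(2) vec.span_superset[of "{x, y}"] by auto
  then have "(\<lambda>P. chi W P - chi X P) \<in> chi_lattice h" "(\<lambda>P. chi X P - chi W' P) \<in> chi_lattice h"
    using meet x y X W W' by blast+
  then show ?thesis
    by (rule chi_lattice_lincomb[where a = 1 and b = 1]) simp
qed

text \<open>Induction upwards along pencils. A step uses dimensions one and two below that of U,
  hence the two base cases h and h + 1.\<close>

lemma chi_lattice_high_dim:
  fixes U W :: "('a::{field,finite} ^ 'n::finite) set"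
  assumes h: "h \<ge> 1" and W: "vec.subspace W" "vec.dim W = Suc h"
    and "vec.subspace U" "h \<le> vec.dim U"
  shows "(\<lambda>P. chi U P - q_int CARD('a) (vec.dim U) * chi W P) \<in> chi_lattice h"
  using assms(4-)
proof (induction "vec.dim U" arbitrary: U rule: less_induct)
  case less
  define q where "q = CARD('a)"
  have q: "q \<ge> 2" by (simp add: q_def card_field_ge_2)
  consider "vec.dim U = h" | "vec.dim U = Suc h" | e where "vec.dim U = Suc (Suc (h + e))"
    using less.prems(2) by (metis add_Suc_right le_Suc_ex not0_implies_Suc add_0_right)
  then show ?case
  proof cases
    case 1
    show ?thesis
      by (rule chi_lattice_lincomb[where a = 1 and b = "-1",
            OF chi_in_chi_lattice[OF less.prems(1) 1] chi_lattice_Suc[OF W]])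
        (simp add: 1)
  next
    \<comment> \<open>Here [h+1] = 1 + q [h]: one copy of W is exchanged for U, and q [h] copies lie
      in the lattice.\<close>
    case 2
    show ?thesis
      by (rule chi_lattice_lincomb[where a = 1 and b = "- int q",
            OF chi_lattice_Suc_diff[OF h less.prems(1) 2 W] chi_lattice_Suc[OF W]])
        (simp add: 2 q_def[symmetric] q_int_Suc[OF q] algebra_simps)
  next
    case 3
    obtain K where K: "vec.subspace K" "K \<subseteq> U" "vec.dim K = h + e"
      using subspace_between[of "{0}" U "h + e"] less.prems 3 by (auto simp: vec.subspace_0)
    have "vec.dim U = vec.dim K + 2" using K 3 by simp
    then obtain G :: "'a option \<Rightarrow> ('a ^ 'n) set" where
      G: "\<And>a. vec.subspace (G a)" "\<And>a. G a \<subseteq> U" "\<And>a. vec.dim (G a) = vec.dim K + 1"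
        "\<And>P. P \<in> points \<Longrightarrow> (\<Sum>a\<in>UNIV. chi (G a) P) = chi U P + int q * chi K P"
      using pencil[OF K(1) less.prems(1) K(2), folded q_def] by blast
    have "(\<lambda>P. chi (G a) P - q_int q (Suc (h + e)) * chi W P) \<in> chi_lattice h" for a
      using less.hyps[of "G a"] G K 3 by (simp add: q_def)
    then have "(\<lambda>P. \<Sum>a\<in>UNIV. chi (G a) P - q_int q (Suc (h + e)) * chi W P) \<in> chi_lattice h"
      by (intro chi_lattice_sum)
    moreover have "(\<lambda>P. chi K P - q_int q (h + e) * chi W P) \<in> chi_lattice h"
      using less.hyps[of K] K 3 by (simp add: q_def)
    \<comment> \<open>This time the weights 1 and -q cancel the terms in
      \<open>chi K\<close>.\<close>
    ultimately show ?thesis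
    proof (rule chi_lattice_lincomb[where a = 1 and b = "- int q"])
      fix P :: "('a ^ 'n) set"
      assume P: "P \<in> points"
      have "(\<Sum>a\<in>(UNIV :: 'a option set). chi (G a) P - q_int q (Suc (h + e)) * chi W P)
          = chi U P + int q * chi K P - (int q + 1) * q_int q (Suc (h + e)) * chi W P"
        using G(4)[OF P] by (simp add: sum_subtractf card_UNIV_option q_def)
      then show "chi U P - q_int CARD('a) (vec.dim U) * chi W P =
          1 * (\<Sum>a\<in>(UNIV :: 'a option set). chi (G a) P - q_int q (Suc (h + e)) * chi W P)
          + - int q * (chi K P - q_int q (h + e) * chi W P)"
        unfolding 3 q_def[symmetric] q_int_Suc_Suc[OF q] by (simp add: algebra_simps)
    qed
  qed
qed

section \<open>Flags, and the uniform covering of points by all h-spaces\<close>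

lemma flag_exists:
  assumes "k \<le> CARD('n)"
  shows "\<exists>F :: nat \<Rightarrow> ('a::field ^ 'n::finite) set.
    (\<forall>i\<le>k. vec.subspace (F i) \<and> vec.dim (F i) = i) \<and> (\<forall>i\<le>k. \<forall>j\<le>k. i \<le> j \<longrightarrow> F i \<subseteq> F j)"
  using assms
proof (induction k)
  case 0
  show ?case by (rule exI[of _ "\<lambda>_. {0}"]) (auto simp: vec.subspace_0)
next
  case (Suc k)
  then obtain F :: "nat \<Rightarrow> ('a ^ 'n) set" where
    F: "\<forall>i\<le>k. vec.subspace (F i) \<and> vec.dim (F i) = i" "\<forall>i\<le>k. \<forall>j\<le>k. i \<le> j \<longrightarrow> F i \<subseteq> F j"
    by auto
  have "Suc k \<le> vec.dim (UNIV :: ('a ^ 'n) set)" using Suc.prems by (simp add: card_cart_basis)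
  then obtain U where U: "vec.subspace U" "F k \<subseteq> U" "vec.dim U = Suc k"
    using subspace_between[of "F k" UNIV "Suc k"] F by auto
  have "\<And>i. i \<le> k \<Longrightarrow> F i \<subseteq> U" using F U by blast
  then show ?case
    using F U by (intro exI[of _ "F(Suc k := U)"]) (auto simp: le_Suc_eq)
qed

text \<open>Extend x, y to a basis and exchange the two. Being an involution, f is its own inverse,
  so the map it induces on subspaces is visibly bijective.\<close>

lemma swap_vectors:
  fixes x y :: "'a::field ^ 'n::finite"
  assumes "vec.independent {x, y}"
  obtains f where "Vector_Spaces.linear (*s) (*s) f" "f x = y" "f \<circ> f = id"
proof -
  define B where "B = vec.extend_basis {x, y}"
  have B: "{x, y} \<subseteq> B" "vec.independent B" "vec.span B = UNIV"
    using assms vec.extend_basis_superset vec.independent_extend_basis vec.span_extend_basis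
    unfolding B_def by blast+
  define s where "s = (\<lambda>z. if z = x then y else if z = y then x else z)"
  obtain f where f: "Vector_Spaces.linear (*s) (*s) f" "\<forall>z\<in>B. f z = s z"
    using vec.linear_independent_extend[OF B(2), of s] by blast
  have "(f \<circ> f) z = id z" for z
  proof (rule vec.linear_eq_on[of "f \<circ> f" id z B])
    show "Vector_Spaces.linear (*s) (*s) (f \<circ> f)" using f by (simp add: Vector_Spaces.linear_compose)
    show "Vector_Spaces.linear (*s) (*s) (id :: 'a ^ 'n \<Rightarrow> _)" by (rule vec.linear_id)
    show "z \<in> vec.span B" by (simp add: B)
    show "(f \<circ> f) b = id b" if "b \<in> B" for b
      using that f B(1) by (auto simp: s_def)
  qed
  then show ?thesis using that f B(1) by (auto simp: s_def fun_eq_iff)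
qed

lemma card_subspaces_through:
  fixes x y :: "'a::{field,finite} ^ 'n::finite"
  assumes "x \<noteq> 0" "y \<noteq> 0"
  shows "card {S \<in> subspaces h. x \<in> S} = card {S \<in> subspaces h. y \<in> S}"
\<comment> \<open>A nonzero vector paired with itself gives an independent singleton; the second
  conjunct sends equal vectors to the proportional case, where both lie in the same
  subspaces.\<close>
proof (cases "vec.independent {x, y} \<and> x \<noteq> y")
  case True
  then obtain f where f: "Vector_Spaces.linear (*s) (*s) f" "f x = y" "f \<circ> f = id"
    using swap_vectors by metis
  have ff: "f (f z) = z" for z using f(3) by (simp add: fun_eq_iff)
  have img: "f ` S \<in> subspaces h" if "S \<in> subspaces h" for S
  proof -
    have "inj_on f (vec.span S)" by (metis ff inj_onI)
    then show ?thesis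
      using that f(1) by (auto simp: subspaces_def vec.dim_image_eq vec.linear_subspace_image)
  qed
  have "bij_betw ((`) f) {S \<in> subspaces h. x \<in> S} {S \<in> subspaces h. y \<in> S}"
  proof (rule bij_betwI[where g = "(`) f"])
    show "(`) f \<in> {S \<in> subspaces h. x \<in> S} \<rightarrow> {S \<in> subspaces h. y \<in> S}"
      using img f(2) by blast
    show "(`) f \<in> {S \<in> subspaces h. y \<in> S} \<rightarrow> {S \<in> subspaces h. x \<in> S}"
      using img f(2) ff by (metis (mono_tags, lifting) Pi_I image_eqI mem_Collect_eq)
  qed (simp_all add: image_image ff)
  then show ?thesis by (rule bij_betw_same_card)
next
  case False
  have "\<exists>k. x = k *s y"
  proof (cases "x = y")
    case True
    then show ?thesis by (intro exI[of _ 1]) simp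
  next
    case neq: False
    with False assms have "x \<in> vec.span {y}"
      by (auto simp: vec.independent_insert)
    then show ?thesis by (auto simp: vec.span_singleton)
  qed
  then obtain k where k: "x = k *s y" by blast
  with assms have "k \<noteq> 0" by auto
  then have "x \<in> S \<longleftrightarrow> y \<in> S" if "S \<in> subspaces h" for S
    using that k vec.subspace_scale[of S y k] vec.subspace_scale[of S x "1 / k"]
    by (auto simp: subspaces_def)
  then have "{S \<in> subspaces h. x \<in> S} = {S \<in> subspaces h. y \<in> S}" by blast
  then show ?thesis by simp
qed

text \<open>Every point lies on the same number N of h-spaces, and N is positive because a point
  extends to an h-space.\<close>

lemma sum_chi_subspaces:
  assumes "1 \<le> h" "h \<le> CARD('n)"
  shows "\<exists>N>0. \<forall>P\<in>points.
    (\<Sum>S\<in>subspaces h. chi S P) = int N * chi (UNIV :: ('a::{field,finite} ^ 'n::finite) set) P"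
proof -
  obtain x :: "'a ^ 'n" where x: "x \<noteq> 0"
    by (metis one_neq_zero vec_eq_iff zero_index one_index)
  define N where "N = card {S \<in> subspaces h. x \<in> S}"
  have "vec.dim {x} = 1" using x vec.dim_insert[of x "{}"] by simp
  then obtain S where "vec.subspace S" "vec.span {x} \<subseteq> S" "vec.dim S = h"
    using subspace_between[of "vec.span {x}" UNIV h] assms by (auto simp: card_cart_basis)
  then have "S \<in> {S \<in> subspaces h. x \<in> S}"
    using vec.span_base[of x "{x}"] by (auto simp: subspaces_def)
  then have "N > 0" unfolding N_def by (subst card_gt_0_iff) auto
  moreover have "(\<Sum>S\<in>subspaces h. chi S P) = int N * chi (UNIV :: ('a ^ 'n) set) P"
    if P: "P \<in> points" for P
  proof -
    obtain y where y: "y \<noteq> 0" "P = vec.span {y}" using P by (rule point_cases)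
    have "(\<Sum>S\<in>subspaces h. chi S P) = (\<Sum>S\<in>subspaces h. of_bool (y \<in> S))"
      by (rule sum.cong) (auto simp: y subspaces_def chi_span)
    also have "\<dots> = int (card {S \<in> subspaces h. y \<in> S})"
      by (simp add: sum_of_bool_eq Int_def conj_commute)
    also have "\<dots> = int N" using card_subspaces_through[OF x y(1)] by (simp add: N_def)
    finally show ?thesis by (simp add: chi_def)
  qed
  ultimately show ?thesis by blast
qed

section \<open>From lattice membership to a multiset of h-spaces\<close>

theorem theorem3:
  fixes q r h :: nat and \<epsilon> :: "nat \<Rightarrow> int"
  assumes "primepow q"
    and "CARD('a::{field,finite}) = q"
    and "CARD('n::finite) = r"
    and "1 \<le> h" and "h < r"
    and "\<forall>i. 1 \<le> i \<and> i < h \<longrightarrow> int q ^ (h - i) dvd \<epsilon> i"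
    and "[(\<Sum>i = 1..<r. \<epsilon> i * q_int q i) = 0] (mod q_int q (gcd r h))"
  shows "star_partitionable TYPE('a) TYPE('n) h \<epsilon>"
proof -
  have q: "q \<ge> 2" using assms(2) card_field_ge_2 by metis
  let ?V = "UNIV :: ('a ^ 'n) set"
  have dimV: "vec.dim ?V = r" using assms(3) by (simp add: card_cart_basis)
  obtain F :: "nat \<Rightarrow> ('a ^ 'n) set" where
    flag: "\<forall>i\<le>r. vec.subspace (F i) \<and> vec.dim (F i) = i"
      "\<forall>i\<le>r. \<forall>j\<le>r. i \<le> j \<longrightarrow> F i \<subseteq> F j"
    using flag_exists[of r, where 'a = 'a and 'n = 'n] assms(3) by blast
  then have F: "\<And>i. i \<le> r \<Longrightarrow> vec.subspace (F i)" "\<And>i. i \<le> r \<Longrightarrow> vec.dim (F i) = i"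
    "\<And>i j. i \<le> j \<Longrightarrow> j \<le> r \<Longrightarrow> F i \<subseteq> F j"
    by simp_all
  \<comment> \<open>The reference (h+1)-space is a flag member, so it contains every
    \<open>F i\<close> with i < h. The flag runs up to r so that it exists even for h = r -
    1.\<close>
  define W where "W = F (Suc h)"
  have W: "vec.subspace W" "vec.dim W = Suc h"
    using F[of "Suc h"] assms(5) by (auto simp: W_def)
  have part: "(\<lambda>P. \<epsilon> i * chi (F i) P - \<epsilon> i * q_int q i * chi W P) \<in> chi_lattice h"
    if i: "i \<in> {1..<r}" for i
  proof (cases "i < h")
    case True
    then obtain c where c: "\<epsilon> i = int q ^ (h - i) * c" using assms(6) i by (auto elim: dvdE)
    have "F i \<subseteq> W" using F True assms(5) by (simp add: W_def)
    then have low: "(\<lambda>P. int q ^ (h - i) * chi (F i) P + q_int q (h - i) * chi W P)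
        \<in> chi_lattice h"
      using chi_lattice_low_dim[OF W, of "F i" "h - i"] F[of i] i True assms(2) by simp
    \<comment> \<open>Subtracting c [h] copies of W turns the coefficient c [h-i] into - c q^(h-i)
      [i], which is minus \<open>\<epsilon> i\<close> times [i].\<close>
    have q_h: "q_int q h = q_int q (h - i) + int q ^ (h - i) * q_int q i"
      using q_int_add[OF q, of i "h - i"] True by simp
    show ?thesis
      by (rule chi_lattice_lincomb[where a = c and b = "- c", OF low chi_lattice_Suc[OF W]])
        (simp add: c assms(2) q_h algebra_simps)
  next
    case False
    then have "(\<lambda>P. chi (F i) P - q_int q i * chi W P) \<in> chi_lattice h"
      using chi_lattice_high_dim[OF assms(4) W, of "F i"] F[of i] i assms(2) by simp
    then show ?thesis
      by (rule chi_lattice_scale[where a = "\<epsilon> i"]) (simp add: algebra_simps)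
  qed
  define E where "E = (\<Sum>i = 1..<r. \<epsilon> i * q_int q i)"
  have "(\<lambda>P. \<Sum>i = 1..<r. \<epsilon> i * chi (F i) P - \<epsilon> i * q_int q i * chi W P) \<in> chi_lattice h"
    using part by (rule chi_lattice_sum)
  then have sumF: "(\<lambda>P. (\<Sum>i = 1..<r. \<epsilon> i * chi (F i) P) - E * chi W P) \<in> chi_lattice h"
    by (simp add: E_def sum_subtractf sum_distrib_right)
  have V: "(\<lambda>P. chi ?V P - q_int q r * chi W P) \<in> chi_lattice h"
    using chi_lattice_high_dim[OF assms(4) W, of ?V] dimV assms by simp
  obtain e where e: "E = q_int q (gcd r h) * e"
    using assms(7) by (auto simp: E_def cong_0_iff elim: dvdE)
  obtain x y where xy: "x * q_int q r + y * q_int q h = q_int q (gcd r h)"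
    using q_int_bezout[OF q] by blast
  \<comment> \<open>Multiplying the Bezout identity by e shows that s solves s [r] = E modulo [h].
    It may be negative.\<close>
  define s where "s = x * e"
  have s: "E = s * q_int q r + e * y * q_int q h"
    unfolding e xy[symmetric] s_def by (simp add: algebra_simps)
  have "(\<lambda>P. s * chi ?V P - E * chi W P) \<in> chi_lattice h"
    by (rule chi_lattice_lincomb[where a = s and b = "- e * y", OF V chi_lattice_Suc[OF W]])
      (simp add: s assms(2) algebra_simps)
  from this sumF
  have "(\<lambda>P. s * chi ?V P - (\<Sum>i = 1..<r. \<epsilon> i * chi (F i) P)) \<in> chi_lattice h"
    by (rule chi_lattice_lincomb[where a = 1 and b = "- 1"]) simp
  then obtain c where c: "\<And>P. P \<in> points \<Longrightarrow>
      s * chi ?V P - (\<Sum>i = 1..<r. \<epsilon> i * chi (F i) P) = (\<Sum>S\<in>subspaces h. c S * chi S P)"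
    by (auto simp: chi_lattice_def)
  obtain N where N: "N > 0" "\<And>P. P \<in> points \<Longrightarrow> (\<Sum>S\<in>subspaces h. chi S P) = int N * chi ?V P"
    using sum_chi_subspaces[of h, where 'a = 'a and 'n = 'n] assms by auto
  \<comment> \<open>Adding all h-spaces t times changes c S to c S + t and s to s + t N. Dominating
    every |c S| and |s|, t makes these nonnegative, so the conversions by \<open>nat\<close> lose
    nothing.\<close>
  define t where "t = \<bar>s\<bar> + (\<Sum>S\<in>(subspaces h :: ('a ^ 'n) set set). \<bar>c S\<bar>)"
  have t: "t \<ge> \<bar>s\<bar>" unfolding t_def by (simp add: sum_nonneg)
  have ct: "c S + t \<ge> 0" if "S \<in> subspaces h" for S
    using member_le_sum[of S "subspaces h" "\<lambda>S. \<bar>c S\<bar>"] that by (simp add: t_def)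
  have "t * 1 \<le> t * int N" using t N(1) by (intro mult_left_mono) auto
  then have sN: "s + t * int N \<ge> 0" using t by simp
  define M where "M = (\<Sum>S\<in>(subspaces h :: ('a ^ 'n) set set). replicate_mset (nat (c S + t)) S)"
  have sumM: "(\<Sum>S\<in>#M. f S) = (\<Sum>S\<in>subspaces h. (c S + t) * f S)" for f :: "('a ^ 'n) set \<Rightarrow> int"
  proof -
    have "(\<Sum>S\<in>#(\<Sum>S\<in>A. replicate_mset (nat (c S + t)) S). f S) = (\<Sum>S\<in>A. (c S + t) * f S)"
      if "A \<subseteq> subspaces h" for A
      using finite[of A] that by (induction A) (auto simp: ct)
    then show ?thesis by (simp add: M_def)
  qed
  have "set_mset M \<subseteq> subspaces h"
    unfolding M_def by (auto simp: set_mset_sum split: if_splits)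
  moreover have "(\<Sum>S\<in>#M. chi S P) = int (nat (s + t * int N)) * chi UNIV P
      - (\<Sum>i = 1..<r. \<epsilon> i * chi (F i) P)" if P: "P \<in> points" for P
    using c[OF P] N(2)[OF P] sN
    by (simp add: sumM distrib_right sum.distrib mult.assoc sum_distrib_left[symmetric])
  ultimately show ?thesis
    using F assms(3) unfolding star_partitionable_def partitionable_def
    by (intro exI[of _ "nat (s + t * int N)"] exI[of _ M] exI[of _ F]) (auto simp: subspaces_def)
qed

end
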